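(* Let $\rho^{(t)}$ be a conditional density forecast, $\rho_u$ the unconditional density, and $f^{(t)}=\alpha\rho^{(t)}+(1-\alpha)\rho_u$ their mixture with $\alpha\in[0,1]$ (with the same $\rho^{(t)}$, i.e. without re-adjusting its kernel width $\sigma$), all as defined in the context. If $H\{\rho^{(t)}\}<H(\rho_u)$, then $H\{\rho^{(t)}\}\le H\{f^{(t)}\}$. That is, in the sense of entropy, merely mixing $\rho^{(t)}$ with the unconditional density without re-adjusting the parameter $\sigma$ cannot improve the sharpness of the predictive distribution.
   Context: For a probability density $f$ on $\mathbb{R}$, $H(f)=-\int_{-\infty}^{\infty} f(x)\log f(x)\,\mathrm{d}x$ is its (differential) entropy; a density is called sharper when its entropy is smaller. Let $K(\xi)=\frac{1}{\sqrt{2\pi}}e^{-\xi^2/2}$. Let $s_1,\dots,s_T\in\mathbb{R}$ be observations and, for a given time $t$, let $X_1^{(t)},\dots,X_N^{(t)}\in\mathbb{R}$ be an ensemble of point forecasts. The conditional density forecast with kernel width $\sigma>0$ and offset $\mu\in\mathbb{R}$ is $\rho^{(t)}(x)=\frac{1}{\sigma N}\sum_{i=1}^N K\{(x-X_i^{(t)}-\mu)/\sigma\}$. The unconditional density is $\rho_u(x)=\frac{1}{\sigma_u T}\sum_{t=1}^T K\{(x-s_t-\mu_u)/\sigma_u\}$ with fixed $\sigma_u>0$ and $\mu_u\in\mathbb{R}$. *)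

theory Defs
  imports "HOL-Probability.Probability"
begin

text \<open>
  Differential entropy of a probability density on the real line. The integral is the Lebesgue
  integral and \<open>ln\<close> the natural logarithm; since \<open>0 * ln 0 = 0\<close>, zeros of \<open>f\<close> contribute nothing.
\<close>

definition differential_entropy :: "(real \<Rightarrow> real) \<Rightarrow> real" where
  "differential_entropy f = - (\<integral>x. f x * ln (f x) \<partial>lborel)"

text \<open>
  Gaussian kernel density with width \<open>\<sigma>\<close> and offset \<open>\<mu>\<close> over the points \<open>Y 1, \<dots>, Y n\<close>. The kernel
  \<open>K \<xi> = exp (- \<xi>\<^sup>2 / 2) / sqrt (2 * pi)\<close> is the library's \<open>std_normal_density\<close>.
\<close>

definition kernel_density :: "real \<Rightarrow> real \<Rightarrow> nat \<Rightarrow> (nat \<Rightarrow> real) \<Rightarrow> real \<Rightarrow> real" where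
  "kernel_density \<sigma> \<mu> n Y x =
     1 / (\<sigma> * real n) * (\<Sum>i=1..n. std_normal_density ((x - Y i - \<mu>) / \<sigma>))"

text \<open>
  \<open>X t i\<close> is the \<open>i\<close>-th point forecast for time \<open>t\<close>, and \<open>s t\<close> is the observation at time \<open>t\<close>.
\<close>

definition conditional_density ::
    "real \<Rightarrow> real \<Rightarrow> nat \<Rightarrow> (nat \<Rightarrow> nat \<Rightarrow> real) \<Rightarrow> nat \<Rightarrow> real \<Rightarrow> real" where
  "conditional_density \<sigma> \<mu> N X t = kernel_density \<sigma> \<mu> N (X t)"

definition unconditional_density ::
    "real \<Rightarrow> real \<Rightarrow> nat \<Rightarrow> (nat \<Rightarrow> real) \<Rightarrow> real \<Rightarrow> real" where
  "unconditional_density \<sigma>\<^sub>u \<mu>\<^sub>u T s = kernel_density \<sigma>\<^sub>u \<mu>\<^sub>u T s"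

definition mixture_density ::
    "real \<Rightarrow> (real \<Rightarrow> real) \<Rightarrow> (real \<Rightarrow> real) \<Rightarrow> real \<Rightarrow> real" where
  "mixture_density \<alpha> f g x = \<alpha> * f x + (1 - \<alpha>) * g x"

end

theory Submission
  imports Defs
begin

text \<open>
  The entropy is concave: since \<open>y \<mapsto> y ln y\<close> is convex,
  \<open>H(f) \<ge> \<alpha> H(\<rho>) + (1 - \<alpha>) H(\<rho>\<^sub>u)\<close>, and the right-hand side is at least \<open>H(\<rho>)\<close> when
  \<open>H(\<rho>) < H(\<rho>\<^sub>u)\<close>. Integrating the pointwise inequality needs every entropy integral to converge;
  this holds because the logarithm of a Gaussian kernel density grows at most quadratically and
  Gaussian second moments are finite.
\<close>

text \<open>Dividing by \<sigma> turns each rescaled kernel into a \<open>normal_density\<close>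
  with mean \<open>Y i + \<mu>\<close>, which gives access to the bounds and moments of the normal
  distribution.\<close>

lemma kernel_density_eq:
  assumes "\<sigma> > 0"
  shows "kernel_density \<sigma> \<mu> n Y x = (\<Sum>i=1..n. normal_density (Y i + \<mu>) \<sigma> x) / n"
proof -
  have "std_normal_density ((x - m - \<mu>) / \<sigma>) = \<sigma> * normal_density (m + \<mu>) \<sigma> x" for m
    using assms
    by (simp add: normal_density_def real_sqrt_mult power_divide algebra_simps)
  then show ?thesis
    using assms by (simp add: kernel_density_def sum_distrib_left[symmetric])
qed

lemma kernel_density_measurable [measurable]:
  "kernel_density \<sigma> \<mu> n Y \<in> borel_measurable borel"
  unfolding kernel_density_def[abs_def] by measurable

lemma kernel_density_pos:
  assumes "\<sigma> > 0" "n \<ge> 1"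
  shows "kernel_density \<sigma> \<mu> n Y x > 0"
  using assms unfolding kernel_density_eq[OF assms(1)]
  by (intro divide_pos_pos sum_pos normal_density_pos) auto

lemma integrable_normal_density_times_square:
  "\<sigma> > 0 \<Longrightarrow> integrable lborel (\<lambda>x. normal_density \<mu> \<sigma> x * (1 + x\<^sup>2))"
proof -
  assume "\<sigma> > 0"
  \<comment> \<open>Expand around the mean: 1 + x^2 = (1 + \<mu>^2) + 2 \<mu> (x - \<mu>) + (x -
    \<mu>)^2, so that only central moments occur.\<close>
  then have "integrable lborel (\<lambda>x. (1 + \<mu>\<^sup>2) * normal_density \<mu> \<sigma> x
      + 2 * \<mu> * (normal_density \<mu> \<sigma> x * (x - \<mu>) ^ 1) + normal_density \<mu> \<sigma> x * (x - \<mu>) ^ 2)"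
    by (intro Bochner_Integration.integrable_add integrable_mult_right
        integrable_normal_moment integrable_normal_density)
  then show ?thesis
    by (rule back_subst[where P = "integrable lborel"])
      (simp add: fun_eq_iff power2_eq_square algebra_simps)
qed

lemma integrable_kernel_density_times_square:
  assumes "\<sigma> > 0"
  shows "integrable lborel (\<lambda>x. kernel_density \<sigma> \<mu> n Y x * (1 + x\<^sup>2))"
  unfolding kernel_density_eq[OF assms] times_divide_eq_left sum_distrib_right
  by (intro integrable_divide_zero Bochner_Integration.integrable_sum
      integrable_normal_density_times_square assms)

text \<open>From above, each component is at most its peak value \<open>1 / c\<close>. From below,
  the average is at least its first component divided by \<open>n\<close>, and the logarithm of that
  is quadratic in \<open>x\<close>.\<close>

lemma abs_ln_kernel_density_le:
  assumes "\<sigma> > 0" "n \<ge> 1"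
  obtains C where "C \<ge> 0" "\<And>x. \<bar>ln (kernel_density \<sigma> \<mu> n Y x)\<bar> \<le> C * (1 + x\<^sup>2)"
proof -
  define m c where "m = Y 1 + \<mu>" and "c = sqrt (2 * pi * \<sigma>\<^sup>2)"
  \<comment> \<open>The summands pay for the peak height, for the division by \<open>n\<close>, and
    for the Gaussian exponent; since 1 + x^2 is at least 1, it absorbs the constants.\<close>
  define C where "C = \<bar>ln c\<bar> + ln n + (1 + m\<^sup>2) / \<sigma>\<^sup>2"
  have c: "c > 0"
    using assms by (simp add: c_def)
  have "\<bar>ln (kernel_density \<sigma> \<mu> n Y x)\<bar> \<le> C * (1 + x\<^sup>2)" for x
  proof -
    let ?f = "kernel_density \<sigma> \<mu> n Y x" and ?q = "(x - m)\<^sup>2 / (2 * \<sigma>\<^sup>2)"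
    have pos: "?f > 0"
      using assms by (rule kernel_density_pos)
    have "(\<Sum>i=1..n. normal_density (Y i + \<mu>) \<sigma> x) \<le> (\<Sum>i=1..n. 1 / c)"
      using c by (intro sum_mono) (simp add: normal_density_def c_def divide_right_mono)
    then have "?f \<le> 1 / c"
      using assms by (simp add: kernel_density_eq field_simps)
    then have upper: "ln ?f \<le> - ln c"
      using pos c by (metis ln_inverse inverse_eq_divide ln_mono)
    have "normal_density m \<sigma> x \<le> (\<Sum>i=1..n. normal_density (Y i + \<mu>) \<sigma> x)"
      unfolding m_def using assms
      by (intro member_le_sum[of 1 _ "\<lambda>i. normal_density (Y i + \<mu>) \<sigma> x"]) auto
    then have "normal_density m \<sigma> x / n \<le> ?f"
      using assms by (simp add: kernel_density_eq divide_right_mono)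
    moreover have "normal_density m \<sigma> x / n = exp (- ?q - ln c - ln n)"
    proof -
      have "exp (- ?q - ln c - ln n) = exp (- ?q) / c / n"
        using c assms by (simp add: exp_diff)
      then show ?thesis
        by (simp add: normal_density_def c_def)
    qed
    ultimately have lower: "- ?q - ln c - ln n \<le> ln ?f"
      using pos by (simp add: ln_ge_iff)
    \<comment> \<open>The nonnegative expression below is exactly the right side minus the left
      side; the factor 2 cancels the one in the denominator of \<open>?q\<close>.\<close>
    have "(x - m)\<^sup>2 \<le> 2 * ((1 + m\<^sup>2) * (1 + x\<^sup>2))"
    proof -
      have "0 \<le> (x + m)\<^sup>2 + 2 * (m * x)\<^sup>2 + 2" by simp
      then show ?thesis by (simp add: power2_eq_square algebra_simps)
    qed
    then have "?q \<le> (1 + m\<^sup>2) / \<sigma>\<^sup>2 * (1 + x\<^sup>2)"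
      using assms by (simp add: field_simps)
    moreover have "\<bar>ln c\<bar> + ln n \<le> (\<bar>ln c\<bar> + ln n) * (1 + x\<^sup>2)"
      using assms by (simp add: distrib_left)
    moreover have "0 \<le> ?q" "0 \<le> ln n"
      using assms by auto
    ultimately show ?thesis
      using upper lower unfolding C_def distrib_right by linarith
  qed
  moreover have "C \<ge> 0"
    using assms by (simp add: C_def)
  ultimately show thesis
    using that by blast
qed

text \<open>The right side is the tangent of y ln y at \<open>b\<close>, evaluated at
  \<open>a\<close>; that it lies below the graph is ln y \<le> y - 1 at y = b / a.\<close>

lemma mult_ln_ge_tangent:
  fixes a b :: real
  assumes "a > 0" "b > 0"
  shows "a * ln a \<ge> a * ln b + a - b"
proof -
  have "a * ln (b / a) \<le> a * (b / a - 1)"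
    using assms by (intro mult_left_mono ln_le_minus_one) auto
  then show ?thesis
    using assms by (simp add: ln_div algebra_simps)
qed

lemma mixture_density_mult_ln_le:
  assumes "f x > 0" "g x > 0" "0 \<le> \<alpha>" "\<alpha> \<le> 1"
  shows "mixture_density \<alpha> f g x * ln (mixture_density \<alpha> f g x)
    \<le> \<alpha> * (f x * ln (f x)) + (1 - \<alpha>) * (g x * ln (g x))"
proof -
  let ?h = "mixture_density \<alpha> f g x"
  have h: "?h > 0"
    unfolding mixture_density_def using convex_bound_lt[of "- f x" 0 "- g x" \<alpha> "1 - \<alpha>"] assms by simp
  \<comment> \<open>Both tangents are taken at the mixture value \<open>?h\<close>, so their
    weighted linear corrections cancel and \<open>?h * ln ?h\<close> remains.\<close>
  have "\<alpha> * (f x * ln ?h + f x - ?h) + (1 - \<alpha>) * (g x * ln ?h + g x - ?h)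
      \<le> \<alpha> * (f x * ln (f x)) + (1 - \<alpha>) * (g x * ln (g x))"
    using assms h by (intro add_mono mult_left_mono mult_ln_ge_tangent) auto
  moreover have "\<alpha> * (f x * ln ?h + f x - ?h) + (1 - \<alpha>) * (g x * ln ?h + g x - ?h) = ?h * ln ?h"
    by (simp add: mixture_density_def algebra_simps)
  ultimately show ?thesis
    by simp
qed

text \<open>A convex combination lies between the smaller and the larger value, and
  \<open>ln\<close> is monotone. The lower bound comes from \<open>convex_bound_le\<close> applied
  to the negated values.\<close>

lemma abs_ln_mixture_density_le:
  assumes "f x > 0" "g x > 0" "0 \<le> \<alpha>" "\<alpha> \<le> 1"
  shows "\<bar>ln (mixture_density \<alpha> f g x)\<bar> \<le> \<bar>ln (f x)\<bar> + \<bar>ln (g x)\<bar>"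
proof -
  let ?h = "mixture_density \<alpha> f g x"
  have le: "min (f x) (g x) \<le> ?h" "?h \<le> max (f x) (g x)"
    unfolding mixture_density_def
    using assms convex_bound_le[of "f x" "max (f x) (g x)" "g x" \<alpha> "1 - \<alpha>"]
      convex_bound_le[of "- f x" "- min (f x) (g x)" "- g x" \<alpha> "1 - \<alpha>"]
    by auto
  have "ln (min (f x) (g x)) \<le> ln ?h" "ln ?h \<le> ln (max (f x) (g x))"
    using le assms by (auto intro!: ln_mono)
  then show ?thesis
    by (auto simp: min_def max_def split: if_splits)
qed

text \<open>Integrability is assumed explicitly because the Bochner integral of a non-integrable
  function is 0, which would break monotonicity and linearity.\<close>

lemma differential_entropy_concave:
  assumes "integrable lborel (\<lambda>x. f x * ln (f x))" "integrable lborel (\<lambda>x. g x * ln (g x))"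
    and "integrable lborel (\<lambda>x. mixture_density \<alpha> f g x * ln (mixture_density \<alpha> f g x))"
    and "\<And>x. f x > 0" "\<And>x. g x > 0" "0 \<le> \<alpha>" "\<alpha> \<le> 1"
  shows "\<alpha> * differential_entropy f + (1 - \<alpha>) * differential_entropy g
    \<le> differential_entropy (mixture_density \<alpha> f g)"
proof -
  have "(\<integral>x. mixture_density \<alpha> f g x * ln (mixture_density \<alpha> f g x) \<partial>lborel)
      \<le> (\<integral>x. \<alpha> * (f x * ln (f x)) + (1 - \<alpha>) * (g x * ln (g x)) \<partial>lborel)"
    using assms by (intro integral_mono mixture_density_mult_ln_le) auto
  also have "\<dots> = \<alpha> * (\<integral>x. f x * ln (f x) \<partial>lborel) + (1 - \<alpha>) * (\<integral>x. g x * ln (g x) \<partial>lborel)"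
    using assms by simp
  finally show ?thesis
    by (simp add: differential_entropy_def)
qed

text \<open>Domination: the mixture is at most \<open>f x + g x\<close> and its logarithm grows at
  most quadratically, so a Gaussian second-moment integrand bounds the product.\<close>

lemma integrable_mixture_kernel_density_mult_ln:
  fixes \<sigma> \<mu> \<sigma>' \<mu>' \<alpha> :: real and m n :: nat and Y Z :: "nat \<Rightarrow> real"
  defines "f \<equiv> kernel_density \<sigma> \<mu> m Y" and "g \<equiv> kernel_density \<sigma>' \<mu>' n Z"
  assumes "\<sigma> > 0" "\<sigma>' > 0" "m \<ge> 1" "n \<ge> 1" "0 \<le> \<alpha>" "\<alpha> \<le> 1"
  shows "integrable lborel (\<lambda>x. mixture_density \<alpha> f g x * ln (mixture_density \<alpha> f g x))"
proof -
  obtain C where C: "C \<ge> 0" "\<And>x. \<bar>ln (f x)\<bar> \<le> C * (1 + x\<^sup>2)"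
    unfolding f_def using abs_ln_kernel_density_le assms by blast
  obtain D where D: "D \<ge> 0" "\<And>x. \<bar>ln (g x)\<bar> \<le> D * (1 + x\<^sup>2)"
    unfolding g_def using abs_ln_kernel_density_le assms by blast
  have pos: "f x > 0" "g x > 0" for x
    using assms by (auto simp: f_def g_def intro: kernel_density_pos)
  have [measurable]: "f \<in> borel_measurable borel" "g \<in> borel_measurable borel"
    by (auto simp: f_def g_def)
  have "integrable lborel (\<lambda>x. (C + D) * (f x * (1 + x\<^sup>2) + g x * (1 + x\<^sup>2)))"
    unfolding f_def g_def using assms
    by (intro integrable_mult_right Bochner_Integration.integrable_add
        integrable_kernel_density_times_square)
  then show ?thesis
  proof (rule Bochner_Integration.integrable_bound)
    show "(\<lambda>x. mixture_density \<alpha> f g x * ln (mixture_density \<alpha> f g x)) \<in> borel_measurable lborel"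
      unfolding mixture_density_def by measurable
    show "AE x in lborel. norm (mixture_density \<alpha> f g x * ln (mixture_density \<alpha> f g x))
        \<le> norm ((C + D) * (f x * (1 + x\<^sup>2) + g x * (1 + x\<^sup>2)))"
    proof (rule AE_I2)
      fix x :: real
      let ?h = "mixture_density \<alpha> f g x"
      have "\<bar>ln ?h\<bar> \<le> (C + D) * (1 + x\<^sup>2)"
        using abs_ln_mixture_density_le[of f x g \<alpha>] assms(7,8) pos[of x] C(2)[of x] D(2)[of x]
        by (simp add: distrib_right)
      moreover have "0 \<le> ?h" "?h \<le> f x + g x"
        using assms(7,8) pos[of x] unfolding mixture_density_def
        by (auto intro!: add_nonneg_nonneg add_mono mult_left_le_one_le)
      ultimately have "?h * \<bar>ln ?h\<bar> \<le> (f x + g x) * ((C + D) * (1 + x\<^sup>2))"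
        by (intro mult_mono) auto
      then have "norm (?h * ln ?h) \<le> (C + D) * (f x * (1 + x\<^sup>2) + g x * (1 + x\<^sup>2))"
        using \<open>0 \<le> ?h\<close> by (simp add: abs_mult algebra_simps)
      then show "norm (?h * ln ?h) \<le> norm ((C + D) * (f x * (1 + x\<^sup>2) + g x * (1 + x\<^sup>2)))"
        by simp
    qed
  qed
qed

lemma integrable_kernel_density_mult_ln:
  assumes "\<sigma> > 0" "n \<ge> 1"
  shows "integrable lborel (\<lambda>x. kernel_density \<sigma> \<mu> n Y x * ln (kernel_density \<sigma> \<mu> n Y x))"
  \<comment> \<open>With weight 1 the mixture collapses to its first component.\<close>
  using integrable_mixture_kernel_density_mult_ln[of \<sigma> \<sigma> n n 1 \<mu> Y \<mu> Y] assms
  by (simp add: mixture_density_def)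

theorem proposition4:
  fixes \<sigma> \<mu> \<sigma>\<^sub>u \<mu>\<^sub>u \<alpha> :: real
    and N T t :: nat
    and X :: "nat \<Rightarrow> nat \<Rightarrow> real"
    and s :: "nat \<Rightarrow> real"
  assumes "\<sigma> > 0" and "\<sigma>\<^sub>u > 0"
    and "N \<ge> 1" and "T \<ge> 1"
    and "0 \<le> \<alpha>" and "\<alpha> \<le> 1"
    and "differential_entropy (conditional_density \<sigma> \<mu> N X t)
       < differential_entropy (unconditional_density \<sigma>\<^sub>u \<mu>\<^sub>u T s)"
  shows "differential_entropy (conditional_density \<sigma> \<mu> N X t)
       \<le> differential_entropy
            (mixture_density \<alpha> (conditional_density \<sigma> \<mu> N X t)
               (unconditional_density \<sigma>\<^sub>u \<mu>\<^sub>u T s))"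
proof -
  let ?f = "conditional_density \<sigma> \<mu> N X t" and ?g = "unconditional_density \<sigma>\<^sub>u \<mu>\<^sub>u T s"
  have "differential_entropy ?f
      = \<alpha> * differential_entropy ?f + (1 - \<alpha>) * differential_entropy ?f"
    by (simp add: algebra_simps)
  \<comment> \<open>The entropy hypothesis enters here, scaled by 1 - \<alpha>; this factor may be
    0, so the inequality becomes weak.\<close>
  also have "\<dots> \<le> \<alpha> * differential_entropy ?f + (1 - \<alpha>) * differential_entropy ?g"
    using assms by (intro add_left_mono mult_left_mono) auto
  also have "\<dots> \<le> differential_entropy (mixture_density \<alpha> ?f ?g)"
    unfolding conditional_density_def unconditional_density_def using assms
    by (intro differential_entropy_concave integrable_kernel_density_mult_ln
        integrable_mixture_kernel_density_mult_ln kernel_density_pos)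
  finally show ?thesis .
qed

end
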